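(* Let $\{X_t:t=0,1,2,\ldots\}$ be an irreducible, positive recurrent, discrete-time birth-and-death process on $\{0,1,2,\ldots\}$ with stationary distribution $(\pi_j)_{j\ge0}$, whose one-step transition probabilities from $n$ to $n+1$ are $\lambda_n>0$ ($n\ge 0$) and from $n$ to $n-1$ are $\mu_n>0$ ($n\ge1$). Let $\theta_j=\inf\{t\ge0:X_t=j\}$. Then the series $$\sum_{j\ge0}\pi_j\,\mathrm{E}_0[\theta_j]$$ diverges (equals $+\infty$).
   Context: $\mathrm{E}_i[\cdot]$ denotes conditional expectation given $X_0=i$. From state $n$ the process can move only to $n+1$, to $n-1$ (if $n\ge1$), or stay in $n$ with the remaining probability. *)

theory Defs
  imports "HOL-Probability.Probability"
begin

text \<open>A time-homogeneous Markov chain on the natural numbers with transition kernel \<open>K\<close>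
  (the transition probability from \<open>i\<close> to \<open>j\<close> is \<open>pmf (K i) j\<close>) and arbitrary initial law.\<close>

definition markov_chain :: "'a measure \<Rightarrow> (nat \<Rightarrow> 'a \<Rightarrow> nat) \<Rightarrow> (nat \<Rightarrow> nat pmf) \<Rightarrow> bool" where
  "markov_chain M X K \<longleftrightarrow>
     prob_space M \<and>
     (\<forall>t. X t \<in> measurable M (count_space UNIV)) \<and>
     (\<forall>t s j. \<P>(\<omega> in M. \<forall>k\<le>t. X k \<omega> = s k) > 0 \<longrightarrow>
        \<P>(\<omega> in M. X (Suc t) \<omega> = j \<bar> \<forall>k\<le>t. X k \<omega> = s k) = pmf (K (s t)) j)"

text \<open>\<open>Pr i\<close> is the law of the chain conditioned on \<open>X\<^sub>0 = i\<close>. Keeping these laws as a family makes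
  them available for every \<open>i\<close>, whatever the initial law of the chain may be.\<close>

definition markov_family :: "(nat \<Rightarrow> 'a measure) \<Rightarrow> (nat \<Rightarrow> 'a \<Rightarrow> nat) \<Rightarrow> (nat \<Rightarrow> nat pmf) \<Rightarrow> bool" where
  "markov_family Pr X K \<longleftrightarrow>
     (\<forall>i. markov_chain (Pr i) X K \<and> \<P>(\<omega> in Pr i. X 0 \<omega> = i) = 1)"

text \<open>Here \<open>n - 1\<close> is truncated, so that only \<open>0\<close> and \<open>1\<close> can be reached from \<open>0\<close> in one step;
  the value \<open>mu 0\<close> is irrelevant.\<close>

definition birth_death_kernel :: "(nat \<Rightarrow> nat pmf) \<Rightarrow> (nat \<Rightarrow> real) \<Rightarrow> (nat \<Rightarrow> real) \<Rightarrow> bool" where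
  "birth_death_kernel K lam mu \<longleftrightarrow>
     (\<forall>n. pmf (K n) (n + 1) = lam n) \<and>
     (\<forall>n\<ge>1. pmf (K n) (n - 1) = mu n) \<and>
     (\<forall>n. set_pmf (K n) \<subseteq> {n - 1, n, n + 1})"

definition irreducible_chain :: "(nat \<Rightarrow> 'a measure) \<Rightarrow> (nat \<Rightarrow> 'a \<Rightarrow> nat) \<Rightarrow> bool" where
  "irreducible_chain Pr X \<longleftrightarrow> (\<forall>i j. \<exists>t. \<P>(\<omega> in Pr i. X t \<omega> = j) > 0)"

text \<open>Both times are \<open>\<infinity>\<close> if the state is never visited.\<close>

definition hitting_time :: "(nat \<Rightarrow> 'a \<Rightarrow> nat) \<Rightarrow> nat \<Rightarrow> 'a \<Rightarrow> enat" where
  "hitting_time X j \<omega> = (INF t\<in>{t. X t \<omega> = j}. enat t)"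

definition return_time :: "(nat \<Rightarrow> 'a \<Rightarrow> nat) \<Rightarrow> nat \<Rightarrow> 'a \<Rightarrow> enat" where
  "return_time X j \<omega> = (INF t\<in>{t. t \<ge> 1 \<and> X t \<omega> = j}. enat t)"

definition positive_recurrent :: "(nat \<Rightarrow> 'a measure) \<Rightarrow> (nat \<Rightarrow> 'a \<Rightarrow> nat) \<Rightarrow> bool" where
  "positive_recurrent Pr X \<longleftrightarrow>
     (\<forall>i. (\<integral>\<^sup>+ \<omega>. ennreal_of_enat (return_time X i \<omega>) \<partial>Pr i) < \<infinity>)"

definition stationary_distribution :: "(nat \<Rightarrow> nat pmf) \<Rightarrow> nat pmf \<Rightarrow> bool" where
  "stationary_distribution K p \<longleftrightarrow> (\<forall>j. (\<lambda>i. pmf p i * pmf (K i) j) sums pmf p j)"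

end

(* Stationarity gives pi_0 P_0(X_t = j) <= pi_j for every t, so by the union bound
   P_0(theta_j < N) <= N pi_j / pi_0. Taking N close to pi_0 / (2 pi_j) yields
   E_0[theta_j] >= N / 2, so pi_j E_0[theta_j] >= pi_0 / 8 as soon as pi_j <= pi_0 / 4.
   Since pi_j tends to 0, the terms of the series stay away from 0. *)

theory Submission
  imports Defs
begin

text \<open>Law of total probability in additive form. It serves below with \<open>f\<close> the
  whole history up to time \<open>t\<close> and with \<open>f\<close> the single variable
  \<open>X t\<close>.\<close>

lemma emeasure_partition_countable:
  fixes f :: "'a \<Rightarrow> 'b::countable"
  assumes A: "A \<in> sets M" and f: "f \<in> measurable M (count_space UNIV)"
  shows "emeasure M A = (\<integral>\<^sup>+ i. emeasure M {\<omega>\<in>A. f \<omega> = i} \<partial>count_space UNIV)"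
proof -
  have eq: "{\<omega>\<in>A. f \<omega> = i} = A \<inter> (f -` {i} \<inter> space M)" for i
    using sets.sets_into_space[OF A] by auto
  have "{\<omega>\<in>A. f \<omega> = i} \<in> sets M" for i
    unfolding eq using A f by (intro sets.Int measurable_sets[OF f]) auto
  then have "emeasure M (\<Union>i\<in>UNIV. {\<omega>\<in>A. f \<omega> = i}) =
      (\<integral>\<^sup>+ i. emeasure M {\<omega>\<in>A. f \<omega> = i} \<partial>count_space UNIV)"
    by (intro emeasure_UN_countable) (auto simp: disjoint_family_on_def)
  moreover have "(\<Union>i\<in>UNIV. {\<omega>\<in>A. f \<omega> = i}) = A" by auto
  ultimately show ?thesis by simp
qed

text \<open>Multiplying out the conditional probability gives a product form that also covers
  histories of probability zero: there both sides vanish.\<close>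

lemma markov_chain_path_step:
  assumes "markov_chain M X K"
  shows "emeasure M {\<omega>\<in>space M. (\<forall>k\<le>t. X k \<omega> = s k) \<and> X (Suc t) \<omega> = j} =
    emeasure M {\<omega>\<in>space M. \<forall>k\<le>t. X k \<omega> = s k} * ennreal (pmf (K (s t)) j)"
proof -
  interpret prob_space M using assms by (simp add: markov_chain_def)
  have [measurable]: "X k \<in> measurable M (count_space UNIV)" for k
    using assms by (simp add: markov_chain_def)
  let ?P = "{\<omega>\<in>space M. \<forall>k\<le>t. X k \<omega> = s k}"
  let ?Q = "{\<omega>\<in>space M. (\<forall>k\<le>t. X k \<omega> = s k) \<and> X (Suc t) \<omega> = j}"
  have "prob ?Q = prob ?P * pmf (K (s t)) j"
  proof (cases "prob ?P > 0")
    case True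
    then have "\<P>(\<omega> in M. X (Suc t) \<omega> = j \<bar> \<forall>k\<le>t. X k \<omega> = s k) = pmf (K (s t)) j"
      using assms by (simp add: markov_chain_def)
    then show ?thesis
      using True by (simp add: cond_prob_def conj_commute field_simps)
  next
    case False
    then have "prob ?P = 0" using measure_nonneg[of M ?P] by linarith
    moreover have "prob ?Q \<le> prob ?P" by (intro finite_measure_mono) auto
    ultimately show ?thesis using measure_nonneg[of M ?Q] by simp
  qed
  then show ?thesis by (simp add: emeasure_eq_measure ennreal_mult)
qed

text \<open>\<open>markov_chain\<close> conditions on full histories only. The transition law given
  just \<open>X t\<close> is recovered by summing over the countably many histories that end in a
  given state.\<close>

lemma markov_chain_step:
  assumes "markov_chain M X K"
  shows "emeasure M {\<omega>\<in>space M. X (Suc t) \<omega> = j} =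
    (\<integral>\<^sup>+ i. emeasure M {\<omega>\<in>space M. X t \<omega> = i} * ennreal (pmf (K i) j) \<partial>count_space UNIV)"
proof -
  have X[measurable]: "X k \<in> measurable M (count_space UNIV)" for k
    using assms by (simp add: markov_chain_def)
  \<comment> \<open>Encoding the history as a list keeps its values in a countable type, as the
    partition lemma requires; functions from \<open>nat\<close> to \<open>nat\<close> would
    not.\<close>
  define path where "path \<omega> = map (\<lambda>k. X k \<omega>) [0..<Suc t]" for \<omega>
  have path_eq: "path \<omega> = l \<longleftrightarrow> length l = Suc t \<and> (\<forall>k\<le>t. X k \<omega> = l ! k)" for \<omega> l
    unfolding path_def list_eq_iff_nth_eq by (auto simp: less_Suc_eq_le simp del: upt_Suc)
  have path: "path \<in> measurable M (count_space UNIV)"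
  proof (subst measurable_count_space_eq2_countable, intro conjI ballI)
    fix l
    have "path -` {l} \<inter> space M = {\<omega>\<in>space M. length l = Suc t \<and> (\<forall>k\<le>t. X k \<omega> = l ! k)}"
      unfolding path_eq[symmetric] by auto
    also have "\<dots> \<in> sets M" by measurable
    finally show "path -` {l} \<inter> space M \<in> sets M" .
  qed auto
  have step: "emeasure M {\<omega>\<in>{\<omega>\<in>space M. X t \<omega> = i \<and> X (Suc t) \<omega> = j}. path \<omega> = l} =
      emeasure M {\<omega>\<in>{\<omega>\<in>space M. X t \<omega> = i}. path \<omega> = l} * ennreal (pmf (K i) j)" for i l
  \<comment> \<open>A list of another length, or one whose last entry is not \<open>i\<close>, makes
    both events empty. For every other list, \<open>path \<omega> = l\<close> already forces
    \<open>X t \<omega> = i\<close>.\<close>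
  proof (cases "length l = Suc t \<and> l ! t = i")
    case True
    have "{\<omega>\<in>{\<omega>\<in>space M. X t \<omega> = i \<and> X (Suc t) \<omega> = j}. path \<omega> = l} =
        {\<omega>\<in>space M. (\<forall>k\<le>t. X k \<omega> = l ! k) \<and> X (Suc t) \<omega> = j}"
      "{\<omega>\<in>{\<omega>\<in>space M. X t \<omega> = i}. path \<omega> = l} = {\<omega>\<in>space M. \<forall>k\<le>t. X k \<omega> = l ! k}"
      using True by (auto simp: path_eq)
    then show ?thesis
      using markov_chain_path_step[OF assms, of t "\<lambda>k. l ! k" j] True by simp
  next
    case False
    then have "{\<omega>\<in>{\<omega>\<in>space M. X t \<omega> = i \<and> X (Suc t) \<omega> = j}. path \<omega> = l} = {}"
      "{\<omega>\<in>{\<omega>\<in>space M. X t \<omega> = i}. path \<omega> = l} = {}"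
      by (auto simp: path_eq)
    then show ?thesis by (simp only: emeasure_empty mult_zero_left)
  qed
  \<comment> \<open>The factor \<open>pmf (K i) j\<close> is the same for all histories ending in
    \<open>i\<close>, so it comes out of the sum over \<open>l\<close>.\<close>
  have "emeasure M {\<omega>\<in>{\<omega>\<in>space M. X (Suc t) \<omega> = j}. X t \<omega> = i} =
      emeasure M {\<omega>\<in>space M. X t \<omega> = i} * ennreal (pmf (K i) j)" for i
  proof -
    have "{\<omega>\<in>{\<omega>\<in>space M. X (Suc t) \<omega> = j}. X t \<omega> = i} =
        {\<omega>\<in>space M. X t \<omega> = i \<and> X (Suc t) \<omega> = j}" by auto
    also have "emeasure M \<dots> = (\<integral>\<^sup>+ l. emeasure M {\<omega>\<in>{\<omega>\<in>space M. X t \<omega> = i}. path \<omega> = l} *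
        ennreal (pmf (K i) j) \<partial>count_space UNIV)"
      unfolding step[symmetric] by (rule emeasure_partition_countable[OF _ path]) measurable
    also have "\<dots> = emeasure M {\<omega>\<in>space M. X t \<omega> = i} * ennreal (pmf (K i) j)"
      by (subst emeasure_partition_countable[OF _ path, of "{\<omega>\<in>space M. X t \<omega> = i}"])
        (auto simp: nn_integral_multc)
    finally show ?thesis .
  qed
  then show ?thesis
    by (subst emeasure_partition_countable[OF _ X[of t]]) simp_all
qed

lemma stationary_distribution_nn_integral:
  assumes "stationary_distribution K p"
  shows "(\<integral>\<^sup>+ i. ennreal (pmf p i) * ennreal (pmf (K i) j) \<partial>count_space UNIV) = ennreal (pmf p j)"
proof -
  have sums: "(\<lambda>i. pmf p i * pmf (K i) j) sums pmf p j"
    using assms by (simp add: stationary_distribution_def)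
  show ?thesis
    using suminf_ennreal_eq[OF _ sums]
    by (simp add: nn_integral_count_space_nat ennreal_mult)
qed

text \<open>At time 0 the law of the chain, scaled by \<open>pmf p i\<close>, is a point mass at
  \<open>i\<close> lying below \<open>p\<close>. One step of the kernel is monotone and fixes
  \<open>p\<close>, so the domination persists.\<close>

lemma stationary_occupation_bound:
  assumes chain: "markov_chain M X K" and start: "\<P>(\<omega> in M. X 0 \<omega> = i) = 1"
    and stat: "stationary_distribution K p"
  shows "ennreal (pmf p i) * emeasure M {\<omega>\<in>space M. X t \<omega> = j} \<le> ennreal (pmf p j)"
proof (induction t arbitrary: j)
  case 0
  interpret prob_space M using chain by (simp add: markov_chain_def)
  have [measurable]: "X k \<in> measurable M (count_space UNIV)" for k
    using chain by (simp add: markov_chain_def)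
  show ?case
  proof (cases "j = i")
    case True
    then show ?thesis using start by (simp add: emeasure_eq_measure)
  next
    case False
    have "AE \<omega> in M. X 0 \<omega> = i" using start by (subst (asm) prob_Collect_eq_1) auto
    then have "AE \<omega> in M. X 0 \<omega> \<noteq> j" by eventually_elim (use False in simp)
    then have "prob {\<omega>\<in>space M. X 0 \<omega> = j} = 0" by (subst prob_Collect_eq_0) auto
    then show ?thesis by (simp add: emeasure_eq_measure)
  qed
next
  case (Suc t)
  have "ennreal (pmf p i) * emeasure M {\<omega>\<in>space M. X (Suc t) \<omega> = j} =
      (\<integral>\<^sup>+ k. ennreal (pmf p i) * emeasure M {\<omega>\<in>space M. X t \<omega> = k} * ennreal (pmf (K k) j)
        \<partial>count_space UNIV)"
    unfolding markov_chain_step[OF chain] by (simp add: nn_integral_cmult[symmetric] mult.assoc)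
  \<comment> \<open>The induction hypothesis is used at every intermediate state \<open>k\<close>,
    hence the induction with \<open>j\<close> arbitrary.\<close>
  also have "\<dots> \<le> (\<integral>\<^sup>+ k. ennreal (pmf p k) * ennreal (pmf (K k) j) \<partial>count_space UNIV)"
    by (intro nn_integral_mono mult_right_mono Suc.IH) simp
  also have "\<dots> = ennreal (pmf p j)"
    by (rule stationary_distribution_nn_integral[OF stat])
  finally show ?case .
qed

lemma hitting_time_ge:
  assumes "\<And>t. t < N \<Longrightarrow> X t \<omega> \<noteq> j"
  shows "enat N \<le> hitting_time X j \<omega>"
  unfolding hitting_time_def using assms by (intro INF_greatest) (auto simp: not_less[symmetric])

text \<open>Markov's inequality at level \<open>N\<close> combined with a union bound over the times
  below \<open>N\<close>. \<open>N\<close> stays free for later optimisation; when the real bound is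
  negative, \<open>ennreal\<close> turns it into 0.\<close>

lemma expected_hitting_time_lower_bound:
  assumes chain: "markov_chain M X K" and start: "\<P>(\<omega> in M. X 0 \<omega> = i) = 1"
    and stat: "stationary_distribution K p"
    and pos: "pmf p i > 0"
  shows "ennreal (real N * (1 - real N * (pmf p j / pmf p i))) \<le>
    (\<integral>\<^sup>+ \<omega>. ennreal_of_enat (hitting_time X j \<omega>) \<partial>M)"
proof -
  interpret prob_space M using chain by (simp add: markov_chain_def)
  have [measurable]: "X k \<in> measurable M (count_space UNIV)" for k
    using chain by (simp add: markov_chain_def)
  let ?H = "\<lambda>t. {\<omega>\<in>space M. X t \<omega> = j}"
  let ?A = "{\<omega>\<in>space M. \<forall>t<N. X t \<omega> \<noteq> j}"
  \<comment> \<open>This bound is uniform in \<open>t\<close>, so the union over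
    \<open>t < N\<close> costs only a factor \<open>N\<close>.\<close>
  have "prob (?H t) \<le> pmf p j / pmf p i" for t
    using stationary_occupation_bound[OF chain start stat, of t j] pos
    by (simp add: emeasure_eq_measure ennreal_mult[symmetric] field_simps)
  then have "(\<Sum>t<N. prob (?H t)) \<le> real N * (pmf p j / pmf p i)"
    using sum_bounded_above[of "{..<N}" "\<lambda>t. prob (?H t)" "pmf p j / pmf p i"] by simp
  moreover have "prob (\<Union>t<N. ?H t) \<le> (\<Sum>t<N. prob (?H t))"
    by (intro finite_measure_subadditive_finite) auto
  moreover have "prob (\<Union>t<N. ?H t) = 1 - prob ?A"
  proof -
    have "(\<Union>t<N. ?H t) = space M - ?A" by auto
    then show ?thesis by (simp add: prob_compl)
  qed
  ultimately have "1 - real N * (pmf p j / pmf p i) \<le> prob ?A" by linarith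
  then have "ennreal (real N * (1 - real N * (pmf p j / pmf p i))) \<le> ennreal (real N * prob ?A)"
    by (intro ennreal_leI mult_left_mono) auto
  also have "\<dots> = of_nat N * emeasure M ?A"
    by (simp add: emeasure_eq_measure ennreal_mult ennreal_of_nat_eq_real_of_nat)
  also have "\<dots> = (\<integral>\<^sup>+ \<omega>. of_nat N * indicator ?A \<omega> \<partial>M)"
    by (subst nn_integral_cmult_indicator) auto
  \<comment> \<open>The comparison is pointwise: on \<open>?A\<close> the hitting time is at least
    \<open>N\<close>, possibly infinite, and elsewhere the left side is 0.\<close>
  also have "\<dots> \<le> (\<integral>\<^sup>+ \<omega>. ennreal_of_enat (hitting_time X j \<omega>) \<partial>M)"
  proof (intro nn_integral_mono)
    fix \<omega>
    have "of_nat N \<le> ennreal_of_enat (hitting_time X j \<omega>)" if "\<omega> \<in> ?A"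
      using hitting_time_ge[of N X \<omega> j] that
      by (subst ennreal_of_enat_enat[symmetric], subst ennreal_of_enat_le_iff) auto
    then show "of_nat N * indicator ?A \<omega> \<le> ennreal_of_enat (hitting_time X j \<omega>)"
      by (auto simp: indicator_def)
  qed
  finally show ?thesis .
qed

lemma weighted_expected_hitting_time_lower_bound:
  assumes chain: "markov_chain M X K" and start: "\<P>(\<omega> in M. X 0 \<omega> = i) = 1"
    and stat: "stationary_distribution K p"
    and pos: "pmf p j > 0" and small: "pmf p j \<le> pmf p i / 4"
  shows "ennreal (pmf p i / 8) \<le>
    ennreal (pmf p j) * (\<integral>\<^sup>+ \<omega>. ennreal_of_enat (hitting_time X j \<omega>) \<partial>M)"
proof -
  have i: "pmf p i > 0" using pos small by linarith
  \<comment> \<open>In terms of \<open>a\<close>, the weighted bound is \<open>pmf p i\<close> times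
    x(1 - x) with x = \<open>real N * a\<close>. It remains to place x in [1/4, 1/2], where x(1 - x)
    is at least 1/4 * 1/2.\<close>
  define a where "a = pmf p j / pmf p i"
  have a: "0 < a" "a \<le> 1 / 4" and pj: "pmf p j = pmf p i * a"
    using pos small i by (auto simp: a_def field_simps)
  \<comment> \<open>The largest \<open>N\<close> with \<open>real N * a\<close> at most 1/2.
    Rounding down lowers this product by less than \<open>a\<close>, which is at most 1/4, so it
    stays above 1/4.\<close>
  define N where "N = nat \<lfloor>1 / (2 * a)\<rfloor>"
  have "0 \<le> 1 / (2 * a)" using a by simp
  then have "real N \<le> 1 / (2 * a)" "1 / (2 * a) < real N + 1"
    unfolding N_def by linarith+
  then have N: "real N * a \<le> 1 / 2" "1 / 4 \<le> real N * a"
    using a by (auto simp: field_simps)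
  have "1 / 4 * (1 / 2) \<le> (real N * a) * (1 - real N * a)"
    using N by (intro mult_mono) auto
  then have "pmf p i * (1 / 8) \<le> pmf p i * ((real N * a) * (1 - real N * a))"
    using i by (intro mult_left_mono) auto
  then have "pmf p i / 8 \<le> pmf p j * (real N * (1 - real N * a))"
    by (simp add: pj mult_ac)
  then have "ennreal (pmf p i / 8) \<le> ennreal (pmf p j) * ennreal (real N * (1 - real N * a))"
    using N by (subst ennreal_mult[symmetric]) (auto intro!: ennreal_leI)
  also have "\<dots> \<le> ennreal (pmf p j) * (\<integral>\<^sup>+ \<omega>. ennreal_of_enat (hitting_time X j \<omega>) \<partial>M)"
    unfolding a_def
    by (intro mult_left_mono expected_hitting_time_lower_bound[OF chain start stat i]) simp
  finally show ?thesis .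
qed

text \<open>Some state \<open>i\<close> carries mass since \<open>p\<close> is a probability.
  Irreducibility leads from \<open>i\<close> to \<open>j\<close> in some \<open>t\<close> steps, and
  the occupation bound passes the positivity on to \<open>j\<close>.\<close>

lemma stationary_distribution_positive:
  assumes fam: "markov_family Pr X K" and irr: "irreducible_chain Pr X"
    and stat: "stationary_distribution K p"
  shows "pmf p j > 0"
proof -
  obtain i where i: "pmf p i > 0"
    using set_pmf_not_empty[of p] by (auto simp: set_pmf_iff pmf_nonneg less_le)
  obtain t where t: "\<P>(\<omega> in Pr i. X t \<omega> = j) > 0"
    using irr by (auto simp: irreducible_chain_def)
  have chain: "markov_chain (Pr i) X K" and start: "\<P>(\<omega> in Pr i. X 0 \<omega> = i) = 1"
    using fam by (auto simp: markov_family_def)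
  interpret prob_space "Pr i" using chain by (simp add: markov_chain_def)
  have "pmf p i * \<P>(\<omega> in Pr i. X t \<omega> = j) \<le> pmf p j"
    using stationary_occupation_bound[OF chain start stat, of t j]
    by (simp add: emeasure_eq_measure ennreal_mult[symmetric])
  moreover have "pmf p i * \<P>(\<omega> in Pr i. X t \<omega> = j) > 0" using i t by simp
  ultimately show ?thesis by linarith
qed

text \<open>The series dominates \<open>c\<close> times the counting measure of an infinite tail
  \<open>{m..}\<close>.\<close>

lemma suminf_ennreal_eq_top:
  fixes f :: "nat \<Rightarrow> ennreal"
  assumes "eventually (\<lambda>n. c \<le> f n) sequentially" and "c > 0"
  shows "(\<Sum>n. f n) = \<infinity>"
proof -
  obtain m where m: "\<And>n. n \<ge> m \<Longrightarrow> c \<le> f n"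
    using assms(1) by (auto simp: eventually_sequentially)
  have "\<infinity> = c * emeasure (count_space UNIV) {m..}"
    using assms(2) by (simp add: emeasure_count_space_infinite infinite_Ici ennreal_mult_top)
  also have "\<dots> = (\<integral>\<^sup>+ n. c * indicator {m..} n \<partial>count_space UNIV)"
    by (subst nn_integral_cmult_indicator) auto
  also have "\<dots> \<le> (\<integral>\<^sup>+ n. f n \<partial>count_space UNIV)"
    by (intro nn_integral_mono) (auto simp: indicator_def m)
  also have "\<dots> = (\<Sum>n. f n)" by (rule nn_integral_count_space_nat)
  finally show ?thesis by (simp add: top_unique)
qed

theorem mainTheorem6:
  fixes Pr :: "nat \<Rightarrow> 'a measure"
    and X :: "nat \<Rightarrow> 'a \<Rightarrow> nat"
    and K :: "nat \<Rightarrow> nat pmf"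
    and lam mu :: "nat \<Rightarrow> real"
    and \<pi> :: "nat pmf"
  assumes "markov_family Pr X K"
    and "birth_death_kernel K lam mu"
    and "\<And>n. lam n > 0"
    and "\<And>n. n \<ge> 1 \<Longrightarrow> mu n > 0"
    and "irreducible_chain Pr X"
    and "positive_recurrent Pr X"
    and "stationary_distribution K \<pi>"
  shows "(\<Sum>j. ennreal (pmf \<pi> j) * (\<integral>\<^sup>+ \<omega>. ennreal_of_enat (hitting_time X j \<omega>) \<partial>Pr 0)) = \<infinity>"
proof -
  have pos: "pmf \<pi> j > 0" for j
    using stationary_distribution_positive[OF assms(1,5,7)] .
  have chain: "markov_chain (Pr 0) X K" and start: "\<P>(\<omega> in Pr 0. X 0 \<omega> = 0) = 1"
    using assms(1) by (auto simp: markov_family_def)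
  have "summable (pmf \<pi>)"
    using integrable_pmf[of UNIV \<pi>] by (simp add: integrable_count_space_nat_iff)
  then have "pmf \<pi> \<longlonglongrightarrow> 0" by (rule summable_LIMSEQ_zero)
  \<comment> \<open>The threshold is the smallness condition under which each term is at least
    \<open>pmf \<pi> 0 / 8\<close>, a constant independent of \<open>j\<close>.\<close>
  then have "eventually (\<lambda>j. pmf \<pi> j < pmf \<pi> 0 / 4) sequentially"
    by (rule order_tendstoD) (use pos in simp)
  then have "eventually (\<lambda>j. ennreal (pmf \<pi> 0 / 8) \<le>
      ennreal (pmf \<pi> j) * (\<integral>\<^sup>+ \<omega>. ennreal_of_enat (hitting_time X j \<omega>) \<partial>Pr 0)) sequentially"
    by eventually_elim
      (intro weighted_expected_hitting_time_lower_bound[OF chain start assms(7) pos], simp)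
  then show ?thesis
    by (rule suminf_ennreal_eq_top) (use pos in simp)
qed

end
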